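(* (Scheme I.) Set, for all $k\in\mathcal{K}$, $\sqrt{p_k}=\beta_k^{-1}\zeta$ with $\zeta=\frac{\min_{k\in\mathcal{K}}\sqrt{P_k}\beta_k}{G}$, set the denoising factor $$\lambda=\frac{\pi N\sqrt{K}\,\min_{k\in\mathcal{K}}\sqrt{P_k}\beta_k}{4G},$$ and set the RIS phase shifts $$\theta_n=-\angle h_{p,n}^\ast+\angle\sum_{k=1}^{K}h_{r,k,n}^\ast,\qquad n=1,\dots,N.$$ Then the gradient estimate $\hat{\mathbf{g}}_t$ is unbiased: $\mathbb{E}[\hat{\mathbf{g}}_t]=\mathbf{g}_t$ (expectation over channels and noise, the vectors $\mathbf{g}_{t,k},\tilde{\mathbf{g}}_{t,m}$ being fixed), i.e. $\mathbb{E}[\ell_k]=\frac1K$ for all $k\in\mathcal{K}$ and $\mathbb{E}[\ell_m]=0$ for all $m\in\mathcal{M}$.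
   Context: Let $K,N,M,D\ge 1$ be integers, $\mathcal{K}=\{1,\dots,K\}$ (target devices) and $\mathcal{M}=\{K+1,\dots,K+M\}$ (interferers). The random vectors $\mathbf{h}_p$ and $\mathbf{h}_{r,i}$, $i\in\mathcal{K}\cup\mathcal{M}$, with entries $h_{p,n}$, $h_{r,i,n}$, are mutually independent, each distributed as $\mathcal{CN}(\mathbf{0},\mathbf{I}_N)$ (i.i.d. circularly symmetric complex Gaussian entries of mean $0$ and variance $\mathbb{E}|\cdot|^2=1$), and independent of the noise $\mathbf{z}_t\sim\mathcal{CN}(\mathbf{0},\sigma^2\mathbf{I}_D)$. Deterministic constants: $\beta_i>0$ (large-scale fading), $P_k>0$ (maximum transmit powers), $p_i>0$ (transmit power coefficients), $\lambda>0$ (denoising factor), $G>0$. The local gradients $\mathbf{g}_{t,k}\in\mathbb{R}^D$ satisfy $\|\mathbf{g}_{t,k}\|\le G$; the interference signals $\tilde{\mathbf{g}}_{t,m}\in\mathbb{R}^D$ are arbitrary with $\|\tilde{\mathbf{g}}_{t,m}\|=1$. The reflecting matrix is $\mathbf{\Theta}=\mathrm{diag}\{e^{j\theta_1},\dots,e^{j\theta_N}\}$, $j=\sqrt{-1}$ (phases modulo $2\pi$); $\angle$ is the argument, $^\ast$ conjugation, $^H$ conjugate transpose, $\Re$ the real part. For $i\in\mathcal{K}\cup\mathcal{M}$, $$\ell_i=\frac{\beta_i\sqrt{p_i}}{\lambda}\,\Re\{\mathbf{h}_p^H\mathbf{\Theta}\mathbf{h}_{r,i}\}.$$ The true global gradient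 is $\mathbf{g}_t=\frac1K\sum_{k\in\mathcal{K}}\mathbf{g}_{t,k}$ and its estimate is $$\hat{\mathbf{g}}_t=\sum_{k\in\mathcal{K}}\ell_k\mathbf{g}_{t,k}+\sum_{m\in\mathcal{M}}\ell_m\tilde{\mathbf{g}}_{t,m}+\frac{\Re\{\mathbf{z}_t\}}{\lambda}.$$ *)

theory Defs
  imports "HOL-Probability.Probability" "HOL-Library.Real_Mod"
begin

text \<open>
  The distribution \<open>CN(0, v)\<close>: real and imaginary part are independent, centred Gaussians with
  variance \<open>v / 2\<close> each, so that the second absolute moment is \<open>v\<close>. It is obtained by scaling
  \<open>CN(0, 1)\<close>, so that \<open>CN(0, 0)\<close> is the point mass at the origin.
\<close>

definition complex_normal :: "real \<Rightarrow> complex measure" where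
  "complex_normal v =
     distr (density lborel (normal_density 0 (sqrt (1 / 2))) \<Otimes>\<^sub>M
            density lborel (normal_density 0 (sqrt (1 / 2)))) borel
       (\<lambda>(x, y). complex_of_real (sqrt v) * (complex_of_real x + \<i> * complex_of_real y))"

definition cn_vector :: "'w measure \<Rightarrow> real \<Rightarrow> ('w \<Rightarrow> complex ^ 'n) \<Rightarrow> bool" where
  "cn_vector \<Omega> v X \<longleftrightarrow>
     X \<in> borel_measurable \<Omega> \<and>
     prob_space.indep_vars \<Omega> (\<lambda>_. borel) (\<lambda>n \<omega>. X \<omega> $ n) UNIV \<and>
     (\<forall>n. distr \<Omega> borel (\<lambda>\<omega>. X \<omega> $ n) = complex_normal v)"

text \<open>
  The random vectors \<open>hp\<close> and \<open>hr i\<close>, \<open>i \<in> I\<close>, as one family: \<open>None\<close> is the index of \<open>hp\<close>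
  and \<open>Some i\<close> the index of \<open>hr i\<close>.
\<close>

definition channels ::
  "('w \<Rightarrow> 'v) \<Rightarrow> (nat \<Rightarrow> 'w \<Rightarrow> 'v) \<Rightarrow> nat option \<Rightarrow> 'w \<Rightarrow> 'v" where
  "channels hp hr j = (case j of None \<Rightarrow> hp | Some i \<Rightarrow> hr i)"

definition channel_index :: "nat set \<Rightarrow> nat option set" where
  "channel_index I = insert None (Some ` I)"

text \<open>
  \<open>hp\<close> and all \<open>hr i\<close> are mutually independent; moreover the noise \<open>z\<close> is independent of them
  jointly. As \<open>z\<close> takes values in a different type, this is stated for the generated sigma-algebras.
\<close>

definition channel_model ::
  "'w measure \<Rightarrow> nat set \<Rightarrow> real \<Rightarrow> ('w \<Rightarrow> complex ^ 'n) \<Rightarrow> (nat \<Rightarrow> 'w \<Rightarrow> complex ^ 'n)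
     \<Rightarrow> ('w \<Rightarrow> complex ^ 'd) \<Rightarrow> bool" where
  "channel_model \<Omega> I \<sigma> hp hr z \<longleftrightarrow>
     cn_vector \<Omega> 1 hp \<and> (\<forall>i\<in>I. cn_vector \<Omega> 1 (hr i)) \<and> cn_vector \<Omega> (\<sigma>\<^sup>2) z \<and>
     prob_space.indep_vars \<Omega> (\<lambda>_. borel) (channels hp hr) (channel_index I) \<and>
     prob_space.indep_set \<Omega>
       (sets (vimage_algebra (space \<Omega>) (\<lambda>\<omega>. \<lambda>j\<in>channel_index I. channels hp hr j \<omega>)
                (Pi\<^sub>M (channel_index I) (\<lambda>_. borel))))
       (sets (vimage_algebra (space \<Omega>) z borel))"

definition reflecting_matrix :: "real ^ 'n \<Rightarrow> complex ^ 'n ^ 'n" where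
  "reflecting_matrix \<theta> = (\<chi> i j. if i = j then cis (\<theta> $ i) else 0)"

definition hermitian_prod :: "complex ^ 'n \<Rightarrow> complex ^ 'n \<Rightarrow> complex" where
  "hermitian_prod x y = (\<Sum>n\<in>UNIV. cnj (x $ n) * y $ n)"

definition effective_gain ::
  "real \<Rightarrow> real \<Rightarrow> real \<Rightarrow> real ^ 'n \<Rightarrow> complex ^ 'n \<Rightarrow> complex ^ 'n \<Rightarrow> real" where
  "effective_gain \<beta> p lam \<theta> hp hr =
     \<beta> * sqrt p / lam * Re (hermitian_prod hp (reflecting_matrix \<theta> *v hr))"

definition global_gradient :: "nat \<Rightarrow> (nat \<Rightarrow> real ^ 'd) \<Rightarrow> real ^ 'd" where
  "global_gradient K g = (1 / real K) *\<^sub>R (\<Sum>k\<in>{1..K}. g k)"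

definition gradient_estimate ::
  "nat \<Rightarrow> nat \<Rightarrow> real \<Rightarrow> (nat \<Rightarrow> real) \<Rightarrow> (nat \<Rightarrow> real ^ 'd) \<Rightarrow> (nat \<Rightarrow> real ^ 'd)
     \<Rightarrow> complex ^ 'd \<Rightarrow> real ^ 'd" where
  "gradient_estimate K M lam l g gi z =
     (\<Sum>k\<in>{1..K}. l k *\<^sub>R g k) + (\<Sum>m\<in>{K+1..K+M}. l m *\<^sub>R gi m)
       + (1 / lam) *\<^sub>R (\<chi> d. Re (z $ d))"

end

theory Submission
  imports Defs
begin

text \<open>
  The phase shifts turn the \<open>n\<close>-th summand of \<open>hp\<^sup>H \<Theta> hr\<^sub>i\<close> into \<open>\<bar>hp\<^sub>n\<bar> u(T) hr\<^sub>i\<^sub>,\<^sub>n\<close>, where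
  \<open>T = \<Sum>\<^sub>k hr\<^sub>k\<^sub>,\<^sub>n\<close> and \<open>u(T)\<close> is the unit number with \<open>u(T) T = \<bar>T\<bar>\<close>. Summing the real parts of
  \<open>u(T) hr\<^sub>k\<^sub>,\<^sub>n\<close> over the \<open>K\<close> targets gives \<open>\<bar>T\<bar>\<close>, and by exchangeability all of them have the same
  mean, namely \<open>E\<bar>T\<bar> / K\<close>. For an interferer, \<open>hr\<^sub>m\<^sub>,\<^sub>n\<close> is centred and independent of the other factor.

  \<open>E\<bar>T\<bar>\<close> is computed without polar coordinates: \<open>2 \<bar>z\<bar>\<close> is the integral of \<open>\<bar>Re (cis x z)\<bar>\<close> over
  \<open>x \<in> [0, \<pi>]\<close>, and \<open>Re (cis x T)\<close> is a sum of independent real Gaussians, so Fubini reduces the claim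
  to the first absolute moment of a real Gaussian.
\<close>

section \<open>The modulus as an integral over rotations\<close>

lemma nn_integral_abs_Re_rotated:
  "(\<integral>\<^sup>+x. ennreal \<bar>Re (cis x * z)\<bar> * indicator {0..pi} x \<partial>lborel) = ennreal (2 * cmod z)"
proof -
  \<comment> \<open>With \<open>z = rcis (cmod z) a\<close> the integrand is
    \<open>cmod z * \<bar>cos (x + a)\<bar>\<close>, and \<open>[0, \<pi>]\<close> is a full period
    of the absolute cosine, over which it integrates to 2. Assuming \<open>Re z \<ge> 0\<close> puts
    the sign change \<open>\<pi>/2 - a\<close> of the cosine inside that interval.\<close>
  have *: "(\<integral>\<^sup>+x. ennreal \<bar>Re (cis x * z)\<bar> * indicator {0..pi} x \<partial>lborel) = ennreal (2 * cmod z)"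
    if "Re z \<ge> 0" for z
  proof -
    define a where "a = Arg z"
    have a: "\<bar>a\<bar> \<le> pi / 2"
      unfolding a_def using that Arg_Re_nonneg by blast
    have Re_eq: "Re (cis x * z) = cmod z * cos (x + a)" for x
    proof -
      have "z = rcis (cmod z) a"
        unfolding a_def by (simp add: rcis_cmod_Arg)
      then have "cis x * z = rcis (cmod z) (x + a)"
        by (metis cis_rcis_eq rcis_mult mult_1 add.commute)
      then show ?thesis by simp
    qed
    \<comment> \<open>The factor \<open>s\<close> is the sign of the cosine on the piece, 1 before
      the sign change and -1 after it.\<close>
    have FTC: "(\<integral>\<^sup>+x. ennreal (s * (cmod z * cos (x + a))) * indicator {u..v} x \<partial>lborel)
        = ennreal (s * (cmod z * sin (v + a)) - s * (cmod z * sin (u + a)))"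
      if "u \<le> v" "\<And>x. x \<in> {u..v} \<Longrightarrow> 0 \<le> s * cos (x + a)" for s u v
      using that(1)
    proof (rule nn_integral_FTC_Icc[where F="\<lambda>x. s * (cmod z * sin (x + a))", rotated -1])
      show "0 \<le> s * (cmod z * cos (x + a))" if "x \<in> {u..v}" for x
        using \<open>\<And>x. x \<in> {u..v} \<Longrightarrow> 0 \<le> s * cos (x + a)\<close>[of x] that
        by (simp add: mult.left_commute[of s])
    qed (auto intro!: derivative_eq_intros)
    let ?m = "pi / 2 - a"
    have m: "0 \<le> ?m" "?m \<le> pi" using a by auto
    have "(\<integral>\<^sup>+x. ennreal \<bar>Re (cis x * z)\<bar> * indicator {0..pi} x \<partial>lborel) =
      (\<integral>\<^sup>+x. ennreal (1 * (cmod z * cos (x + a))) * indicator {0..?m} x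
        + ennreal ((-1) * (cmod z * cos (x + a))) * indicator {?m..pi} x \<partial>lborel)"
    proof (rule nn_integral_cong)
      fix x :: real
      have "cos (x + a) \<ge> 0" if "0 \<le> x" "x \<le> ?m"
        using that a by (intro cos_ge_zero) auto
      moreover have "cos (x + a) \<le> 0" if "?m \<le> x" "x \<le> pi"
      proof -
        have "0 \<le> cos (x + a - pi)" using that a by (intro cos_ge_zero) auto
        then show ?thesis by (simp add: cos_diff)
      qed
      \<comment> \<open>The two closed pieces share the point \<open>?m\<close>; counting it twice
        is harmless because the integrand vanishes there.\<close>
      moreover have "cos (x + a) = 0" if "x = ?m" using that by simp
      ultimately show "ennreal \<bar>Re (cis x * z)\<bar> * indicator {0..pi} x =
         ennreal (1 * (cmod z * cos (x + a))) * indicator {0..?m} x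
        + ennreal ((-1) * (cmod z * cos (x + a))) * indicator {?m..pi} x"
        using m unfolding Re_eq
        by (auto simp: abs_mult split: split_indicator)
    qed
    also have "\<dots> = (\<integral>\<^sup>+x. ennreal (1 * (cmod z * cos (x + a))) * indicator {0..?m} x \<partial>lborel)
        + (\<integral>\<^sup>+x. ennreal ((-1) * (cmod z * cos (x + a))) * indicator {?m..pi} x \<partial>lborel)"
      by (intro nn_integral_add) auto
    also have "\<dots> = ennreal (1 * (cmod z * sin (?m + a)) - 1 * (cmod z * sin (0 + a)))
       + ennreal ((-1) * (cmod z * sin (pi + a)) - (-1) * (cmod z * sin (?m + a)))"
    proof (intro arg_cong2[where f="(+)"] FTC)
      show "0 \<le> 1 * cos (x + a)" if "x \<in> {0..?m}" for x
        using that a by (simp, intro cos_ge_zero) auto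
      show "0 \<le> - 1 * cos (x + a)" if "x \<in> {?m..pi}" for x
      proof -
        have "0 \<le> cos (x + a - pi)" using that a by (intro cos_ge_zero) auto
        then show ?thesis by (simp add: cos_diff)
      qed
    qed (use m in auto)
    also have "\<dots> = ennreal (2 * cmod z)"
    proof -
      \<comment> \<open>The pieces contribute \<open>cmod z * (1 - sin a)\<close> and
        \<open>cmod z * (1 + sin a)\<close>. Both must be nonnegative before their
        \<open>ennreal\<close> images can be added as reals.\<close>
      have "cmod z * sin a \<le> cmod z * 1" "- (cmod z * 1) \<le> cmod z * sin a"
        using mult_left_mono[OF sin_le_one, of "cmod z" a]
          mult_left_mono[OF sin_ge_minus_one, of "cmod z" a] by auto
      then show ?thesis
        by (subst ennreal_plus[symmetric]) (auto simp: sin_add)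
    qed
    finally show ?thesis .
  qed
  show ?thesis
    \<comment> \<open>The integrand is unchanged under \<open>z \<mapsto> -z\<close>, and one of the
      two numbers has nonnegative real part.\<close>
    using *[of z] *[of "- z"] by (cases "Re z \<ge> 0") (auto simp: abs_minus_commute)
qed

section \<open>Measurability of the phase factors\<close>

lemma borel_measurable_cis [measurable]: "cis \<in> borel_measurable borel"
  by (intro borel_measurable_continuous_onI continuous_intros)

lemma borel_measurable_cnj [measurable]: "cnj \<in> borel_measurable borel"
  by (intro borel_measurable_continuous_onI continuous_intros)

text \<open>\<open>Arg\<close> jumps at the negative real axis, but \<open>cis\<close> removes the
  jump: away from 0 the composite is \<open>sgn\<close>, and at 0 it is 1 since
  \<open>Arg 0 = 0\<close>.\<close>

lemma borel_measurable_cis_Arg [measurable]: "(\<lambda>z. cis (Arg z)) \<in> borel_measurable borel"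
proof -
  have "(\<lambda>z. cis (Arg z)) = (\<lambda>z. if z = 0 then 1 else sgn z)"
    by (auto simp: fun_eq_iff cis_Arg Arg_zero)
  then show ?thesis by simp
qed

lemma borel_measurable_vec_nth [measurable]:
  "(\<lambda>v :: 'a :: real_normed_vector ^ 'm :: finite. v $ n) \<in> borel_measurable borel"
  by (intro borel_measurable_continuous_onI continuous_intros)

section \<open>A single complex normal variable\<close>

context prob_space
begin

text \<open>Taking real and imaginary part inverts the map that defines
  \<open>complex_normal 1\<close>, so their joint law is the underlying product measure. Its
  projections give the marginals, and its product form gives independence.\<close>

lemma complex_normal_Re_Im:
  assumes [measurable]: "random_variable borel X" and D: "distr M borel X = complex_normal 1"
  shows "distributed M lborel (\<lambda>\<omega>. Re (X \<omega>)) (normal_density 0 (sqrt (1 / 2)))"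
    and "distributed M lborel (\<lambda>\<omega>. Im (X \<omega>)) (normal_density 0 (sqrt (1 / 2)))"
    and "indep_var borel (\<lambda>\<omega>. Re (X \<omega>)) borel (\<lambda>\<omega>. Im (X \<omega>))"
proof -
  define N where "N = density lborel (normal_density 0 (sqrt (1 / 2)))"
  interpret N: prob_space N
    unfolding N_def by (rule prob_space_normal_density) simp
  have sets_N [measurable_cong, simp]: "sets N = sets borel" by (simp add: N_def)
  have joint: "distr M (borel \<Otimes>\<^sub>M borel) (\<lambda>\<omega>. (Re (X \<omega>), Im (X \<omega>))) = N \<Otimes>\<^sub>M N"
  proof -
    have "distr M (borel \<Otimes>\<^sub>M borel) (\<lambda>\<omega>. (Re (X \<omega>), Im (X \<omega>)))
        = distr (distr M borel X) (borel \<Otimes>\<^sub>M borel) (\<lambda>z. (Re z, Im z))"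
      by (subst distr_distr) (auto simp: comp_def)
    also have "\<dots> = distr (N \<Otimes>\<^sub>M N) (borel \<Otimes>\<^sub>M borel) (\<lambda>x. x)"
      unfolding D complex_normal_def N_def[symmetric]
      by (subst distr_distr) (auto simp: comp_def case_prod_unfold intro!: distr_cong)
    also have "\<dots> = N \<Otimes>\<^sub>M N"
      by (intro distr_id2) (simp cong: sets_pair_measure_cong)
    finally show ?thesis .
  qed
  have Re: "distr M borel (\<lambda>\<omega>. Re (X \<omega>)) = N"
  proof -
    have "distr M borel (\<lambda>\<omega>. Re (X \<omega>)) = distr (N \<Otimes>\<^sub>M N) N fst"
      unfolding joint[symmetric] by (subst distr_distr) (auto simp: comp_def intro!: distr_cong)
    then show ?thesis by (simp add: N.distr_pair_fst)
  qed
  \<comment> \<open>The second marginal is reduced to the first by swapping the factors.\<close>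
  have Im: "distr M borel (\<lambda>\<omega>. Im (X \<omega>)) = N"
  proof -
    interpret NN: pair_prob_space N N ..
    have "distr (N \<Otimes>\<^sub>M N) N snd = distr (distr (N \<Otimes>\<^sub>M N) (N \<Otimes>\<^sub>M N) (\<lambda>(x, y). (y, x))) N snd"
      by (subst NN.distr_pair_swap[symmetric]) simp
    also have "\<dots> = distr (N \<Otimes>\<^sub>M N) N fst"
      by (subst distr_distr) (auto simp: comp_def case_prod_unfold)
    also have "\<dots> = N" by (simp add: N.distr_pair_fst)
    finally have *: "distr (N \<Otimes>\<^sub>M N) N snd = N" .
    have "distr M borel (\<lambda>\<omega>. Im (X \<omega>)) = distr (N \<Otimes>\<^sub>M N) N snd"
      unfolding joint[symmetric] by (subst distr_distr) (auto simp: comp_def intro!: distr_cong)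
    then show ?thesis by (simp add: *)
  qed
  show "distributed M lborel (\<lambda>\<omega>. Re (X \<omega>)) (normal_density 0 (sqrt (1 / 2)))"
    using Re unfolding N_def distributed_def by (simp cong: distr_cong)
  show "distributed M lborel (\<lambda>\<omega>. Im (X \<omega>)) (normal_density 0 (sqrt (1 / 2)))"
    using Im unfolding N_def distributed_def by (simp cong: distr_cong)
  show "indep_var borel (\<lambda>\<omega>. Re (X \<omega>)) borel (\<lambda>\<omega>. Im (X \<omega>))"
    by (simp add: indep_var_distribution_eq joint Re Im)
qed

text \<open>Needed for the noise, whose variance may be 0, so that its real part need not have a
  density. The integral is therefore taken over the underlying pair of Gaussians, before the scaling
  by \<open>sqrt v\<close>.\<close>

lemma complex_normal_Re_mean:
  assumes [measurable]: "random_variable borel X" and D: "distr M borel X = complex_normal v"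
  shows "has_bochner_integral M (\<lambda>\<omega>. Re (X \<omega>)) 0"
proof -
  define N where "N = density lborel (normal_density 0 (sqrt (1 / 2)))"
  interpret N: prob_space N
    unfolding N_def by (rule prob_space_normal_density) simp
  have sets_N [measurable_cong, simp]: "sets N = sets borel" by (simp add: N_def)
  have "has_bochner_integral N (\<lambda>x. x) 0"
    unfolding N_def using normal_moment_odd[of "sqrt (1/2)" 0 0]
    by (intro has_bochner_integral_density) (auto simp: normal_density_nonneg)
  then have "has_bochner_integral (distr (N \<Otimes>\<^sub>M N) N fst) (\<lambda>x. x) 0"
    by (simp add: N.distr_pair_fst)
  then have "has_bochner_integral (N \<Otimes>\<^sub>M N) (\<lambda>x. fst x) 0"
    by (simp add: has_bochner_integral_iff integrable_distr_eq integral_distr)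
  then have "has_bochner_integral (N \<Otimes>\<^sub>M N) (\<lambda>x. sqrt v * fst x) (sqrt v * 0)"
    by (rule has_bochner_integral_mult_right)
  then have "has_bochner_integral (complex_normal v) Re 0"
    unfolding complex_normal_def N_def[symmetric]
    by (intro has_bochner_integral_distr) (auto simp: case_prod_unfold)
  then show ?thesis
    unfolding D[symmetric] by (simp add: has_bochner_integral_iff integrable_distr_eq integral_distr)
qed

text \<open>Rotation invariance: \<open>cos a * Re X - sin a * Im X\<close> is a sum of independent
  Gaussians with variances \<open>(cos a)^2 / 2\<close> and \<open>(sin a)^2 / 2\<close>, which add
  up to 1/2.\<close>

lemma complex_normal_rotated_Re:
  assumes X: "random_variable borel X" and D: "distr M borel X = complex_normal 1"
  shows "distributed M lborel (\<lambda>\<omega>. Re (cis a * X \<omega>)) (normal_density 0 (sqrt (1 / 2)))"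
proof -
  note RI = complex_normal_Re_Im[OF assms]
  have c: "distributed M lborel (\<lambda>\<omega>. cos a * Re (X \<omega>)) (normal_density 0 (\<bar>cos a\<bar> * sqrt (1 / 2)))"
    if "cos a \<noteq> 0"
    using normal_density_affine[OF RI(1), of "cos a" 0] that by simp
  have s: "distributed M lborel (\<lambda>\<omega>. - sin a * Im (X \<omega>)) (normal_density 0 (\<bar>sin a\<bar> * sqrt (1 / 2)))"
    if "sin a \<noteq> 0"
    using normal_density_affine[OF RI(2), of "- sin a" 0] that by simp
  have eq: "Re (cis a * X \<omega>) = cos a * Re (X \<omega>) + - sin a * Im (X \<omega>)" for \<omega> by simp
  \<comment> \<open>A vanishing coefficient makes its summand constant, without a density; the other
    coefficient then has absolute value 1 and its summand is the whole variable.\<close>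
  consider "cos a = 0" | "sin a = 0" | "cos a \<noteq> 0" "sin a \<noteq> 0" by auto
  then show ?thesis
  proof cases
    case 1
    then have "\<bar>sin a\<bar> = 1" using sin_cos_squared_add[of a] by (auto simp: power2_eq_1_iff)
    with s 1 show ?thesis unfolding eq by fastforce
  next
    case 2
    then have "\<bar>cos a\<bar> = 1" using sin_cos_squared_add[of a] by (auto simp: power2_eq_1_iff)
    with c 2 show ?thesis unfolding eq by fastforce
  next
    case 3
    have "indep_var borel ((\<lambda>x. cos a * x) \<circ> (\<lambda>\<omega>. Re (X \<omega>))) borel ((\<lambda>x. - sin a * x) \<circ> (\<lambda>\<omega>. Im (X \<omega>)))"
      by (intro indep_var_compose[OF RI(3)]) auto
    then have "distributed M lborel (\<lambda>\<omega>. cos a * Re (X \<omega>) + - sin a * Im (X \<omega>))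
      (normal_density (0 + 0) (sqrt ((\<bar>cos a\<bar> * sqrt (1 / 2))\<^sup>2 + (\<bar>sin a\<bar> * sqrt (1 / 2))\<^sup>2)))"
      using 3 by (intro add_indep_normal c s) (auto simp: comp_def)
    moreover have "(\<bar>cos a\<bar> * sqrt (1 / 2))\<^sup>2 + (\<bar>sin a\<bar> * sqrt (1 / 2))\<^sup>2 = 1 / 2"
      using sin_cos_squared_add[of a] by (simp add: power_mult_distrib add_divide_distrib[symmetric])
    ultimately show ?thesis unfolding eq by simp
  qed
qed


text \<open>Stated as a nonnegative integral because it enters Fubini before integrability is known.
  The value is the lowest odd absolute moment of a Gaussian.\<close>

lemma normal_nn_integral_abs:
  assumes "0 < s" and D: "distributed M lborel Y (normal_density 0 s)"
  shows "(\<integral>\<^sup>+\<omega>. ennreal \<bar>Y \<omega>\<bar> \<partial>M) = ennreal (s * sqrt (2 / pi))"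
proof -
  have "(\<integral>\<^sup>+\<omega>. ennreal \<bar>Y \<omega>\<bar> \<partial>M) = (\<integral>\<^sup>+x. ennreal (normal_density 0 s x) * ennreal \<bar>x\<bar> \<partial>lborel)"
    by (subst distributed_nn_integral[OF D]) auto
  also have "\<dots> = (\<integral>\<^sup>+x. ennreal (normal_density 0 s x * \<bar>x\<bar>) \<partial>lborel)"
    by (simp add: ennreal_mult' normal_density_nonneg)
  also have "\<dots> = ennreal (s * sqrt (2 / pi))"
    using normal_moment_abs_odd[OF assms(1), of 0 0]
    by (subst nn_integral_eq_integral) (auto simp: has_bochner_integral_iff normal_density_nonneg)
  finally show ?thesis .
qed

section \<open>Sums and aligned products in an independent family of standard complex
  normals\<close>

context
  fixes X :: "'i \<Rightarrow> 'a \<Rightarrow> complex" and I :: "'i set"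
  assumes indep: "indep_vars (\<lambda>_. borel) X I"
    and cn: "\<And>i. i \<in> I \<Longrightarrow> distr M borel (X i) = complex_normal 1"
begin

lemma indep_vars_random_variable: "i \<in> I \<Longrightarrow> random_variable borel (X i)"
  using indep by (auto simp: indep_vars_def)

text \<open>For each angle the rotated real part of the sum has variance \<open>card J / 2\<close>,
  hence mean absolute value \<open>sqrt (card J / \<pi>)\<close>. Integrating over an interval of
  length \<open>\<pi>\<close> yields twice the claimed mean. Nonemptiness of \<open>J\<close> keeps
  the variance positive.\<close>

lemma complex_normal_sum_cmod:
  assumes J: "J \<subseteq> I" "finite J" "J \<noteq> {}"
  shows "has_bochner_integral M (\<lambda>\<omega>. cmod (\<Sum>i\<in>J. X i \<omega>)) (sqrt (real (card J) * pi) / 2)"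
proof -
  interpret MN: pair_sigma_finite M lborel ..
  define T where "T \<omega> = (\<Sum>i\<in>J. X i \<omega>)" for \<omega>
  have [measurable]: "random_variable borel T"
    unfolding T_def using J indep_vars_random_variable by (intro borel_measurable_sum) auto
  have pos: "0 < real (card J)" using J by (simp add: card_gt_0_iff)
  have abs_Re: "(\<integral>\<^sup>+\<omega>. ennreal \<bar>Re (cis x * T \<omega>)\<bar> \<partial>M) = ennreal (sqrt (real (card J) / pi))" for x
  proof -
    have "indep_vars (\<lambda>_. borel) (\<lambda>i \<omega>. Re (cis x * X i \<omega>)) J"
      by (intro indep_vars_compose2[OF indep_vars_subset[OF indep J(1)]]) auto
    then have "distributed M lborel (\<lambda>\<omega>. \<Sum>i\<in>J. Re (cis x * X i \<omega>))
      (normal_density (\<Sum>i\<in>J. 0) (sqrt (\<Sum>i\<in>J. (sqrt (1 / 2))\<^sup>2)))"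
      using J by (intro sum_indep_normal complex_normal_rotated_Re indep_vars_random_variable cn) auto
    then have "distributed M lborel (\<lambda>\<omega>. Re (cis x * T \<omega>)) (normal_density 0 (sqrt (real (card J) / 2)))"
      by (simp add: T_def sum_distrib_left sum_subtractf)
    from normal_nn_integral_abs[OF _ this] pos show ?thesis
      by (simp add: real_sqrt_mult[symmetric])
  qed
  have "(\<integral>\<^sup>+\<omega>. ennreal (2 * cmod (T \<omega>)) \<partial>M)
      = (\<integral>\<^sup>+\<omega>. \<integral>\<^sup>+x. ennreal \<bar>Re (cis x * T \<omega>)\<bar> * indicator {0..pi} x \<partial>lborel \<partial>M)"
    by (simp only: nn_integral_abs_Re_rotated)
  also have "\<dots> = (\<integral>\<^sup>+x. \<integral>\<^sup>+\<omega>. ennreal \<bar>Re (cis x * T \<omega>)\<bar> * indicator {0..pi} x \<partial>M \<partial>lborel)"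
    by (rule MN.Fubini'[symmetric]) measurable
  also have "\<dots> = (\<integral>\<^sup>+x. ennreal (sqrt (real (card J) / pi)) * indicator {0..pi} x \<partial>lborel)"
    by (intro nn_integral_cong) (simp add: nn_integral_multc abs_Re del: times_complex.sel)
  also have "\<dots> = ennreal (sqrt (real (card J) / pi) * pi)"
    by (simp add: nn_integral_cmult_indicator ennreal_mult')
  also have "sqrt (real (card J) / pi) * pi = sqrt (real (card J) * pi)"
    by (simp add: real_sqrt_divide real_sqrt_mult real_div_sqrt field_simps)
  finally have "has_bochner_integral M (\<lambda>\<omega>. 2 * cmod (T \<omega>)) (sqrt (real (card J) * pi))"
    by (intro has_bochner_integral_nn_integral) auto
  from has_bochner_integral_mult_right[OF this, of "1 / 2"] show ?thesis
    by (simp add: T_def)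
qed

lemma complex_normal_cmod:
  assumes "i \<in> I"
  shows "has_bochner_integral M (\<lambda>\<omega>. cmod (X i \<omega>)) (sqrt pi / 2)"
  using complex_normal_sum_cmod[of "{i}"] assms by simp

lemma complex_normal_integral_0:
  assumes i: "i \<in> I"
  shows "has_bochner_integral M (X i) 0"
proof -
  note [measurable] = indep_vars_random_variable[OF i]
  have *: "expectation (\<lambda>\<omega>. Re (cis a * X i \<omega>)) = 0" for a
    by (rule normal_distributed_expectation[OF _ complex_normal_rotated_Re[OF indep_vars_random_variable cn]]) (use i in auto)
  have int: "integrable M (X i)"
    using complex_normal_cmod[OF i] by (simp add: has_bochner_integral_iff integrable_norm_iff)
  have "expectation (X i) = 0"
    \<comment> \<open>Rotation by 0 exposes the real part, rotation by \<open>-\<pi>/2\<close> the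
      imaginary part.\<close>
    using *[of 0] *[of "- (pi / 2)"] int by (intro complex_eqI) auto
  with int show ?thesis by (simp add: has_bochner_integral_iff)
qed


lemma aligned_summand:
  assumes J: "J \<subseteq> I" "finite J" and i: "i \<in> J"
  shows "has_bochner_integral M
    (\<lambda>\<omega>. Re (cis (Arg (cnj (\<Sum>j\<in>J. X j \<omega>))) * X i \<omega>)) (sqrt (pi / real (card J)) / 2)"
proof -
  \<comment> \<open>\<open>f\<close> acts on a whole tuple, so that exchangeability becomes
    invariance of the product law \<open>P\<close> under permuting coordinates.\<close>
  define f where "f k x = Re (cis (Arg (cnj (\<Sum>j\<in>J. x j))) * x k)" for k and x :: "'i \<Rightarrow> complex"
  define D where "D = complex_normal 1"
  define P where "P = (\<Pi>\<^sub>M j\<in>J. D)"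
  define XJ where "XJ \<omega> = (\<lambda>j\<in>J. X j \<omega>)" for \<omega>
  have rv_J: "random_variable borel (X j)" if "j \<in> J" for j
    using indep_vars_random_variable J that by auto
  have sets_D: "sets D = sets borel"
    by (simp add: D_def complex_normal_def)
  have sets_P [measurable_cong]: "sets P = sets (\<Pi>\<^sub>M j\<in>J. borel)"
    unfolding P_def by (intro sets_PiM_cong refl sets_D)
  have prob_D: "prob_space D"
    using prob_space_distr[OF rv_J[OF i]] cn[of i] J i by (auto simp: D_def)
  have [measurable]: "XJ \<in> measurable M (\<Pi>\<^sub>M j\<in>J. borel)"
    unfolding XJ_def by (intro measurable_restrict rv_J)
  have distr_XJ: "distr M (\<Pi>\<^sub>M j\<in>J. borel) XJ = P"
  proof -
    have "distr M (\<Pi>\<^sub>M j\<in>J. borel) (\<lambda>\<omega>. \<lambda>j\<in>J. X j \<omega>) = (\<Pi>\<^sub>M j\<in>J. distr M borel (X j))"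
      using indep_vars_subset[OF indep J(1)] i
      by (subst indep_vars_iff_distr_eq_PiM'[symmetric]) (auto simp: rv_J)
    also have "\<dots> = P"
      unfolding P_def D_def using J by (intro PiM_cong) (auto simp: cn)
    finally show ?thesis by (simp add: XJ_def[abs_def])
  qed
  have f_meas [measurable]: "f k \<in> borel_measurable (\<Pi>\<^sub>M j\<in>J. borel)" if "k \<in> J" for k
    unfolding f_def using that by measurable
  have int_f: "integrable M (\<lambda>\<omega>. f k (XJ \<omega>))" if k: "k \<in> J" for k
  proof (rule Bochner_Integration.integrable_bound)
    show "integrable M (\<lambda>\<omega>. cmod (X k \<omega>))"
      using complex_normal_cmod[of k] k J by (auto simp: has_bochner_integral_iff)
    show "(\<lambda>\<omega>. f k (XJ \<omega>)) \<in> borel_measurable M" using k by measurable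
    \<comment> \<open>A phase factor has modulus 1, so \<open>cmod (X k \<omega>)\<close>
      dominates.\<close>
    show "AE \<omega> in M. norm (f k (XJ \<omega>)) \<le> norm (cmod (X k \<omega>))"
    proof (rule AE_I2)
      fix \<omega>
      have "\<bar>f k (XJ \<omega>)\<bar> \<le> cmod (cis (Arg (cnj (\<Sum>j\<in>J. XJ \<omega> j))) * XJ \<omega> k)"
        unfolding f_def by (rule abs_Re_le_cmod)
      then show "norm (f k (XJ \<omega>)) \<le> norm (cmod (X k \<omega>))"
        using k by (simp add: norm_mult XJ_def)
    qed
  qed
  have E_P: "expectation (\<lambda>\<omega>. f k (XJ \<omega>)) = (\<integral>x. f k x \<partial>P)" if "k \<in> J" for k
    unfolding distr_XJ[symmetric] using that by (subst integral_distr) auto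
  have exch: "(\<integral>x. f k x \<partial>P) = (\<integral>x. f i x \<partial>P)" if k: "k \<in> J" for k
  proof -
    \<comment> \<open>Swapping \<open>i\<close> and \<open>k\<close> preserves the product of
      identical laws and the sum over \<open>J\<close>, hence the phase, while it carries coordinate
      \<open>k\<close> to coordinate \<open>i\<close>.\<close>
    define \<tau> where "\<tau> = Transposition.transpose i k"
    have \<tau>: "bij_betw \<tau> J J"
      unfolding \<tau>_def using k i by (intro permutes_imp_bij permutes_swap_id)
    then have \<tau>J: "\<tau> \<in> J \<rightarrow> J" and inj: "inj_on \<tau> J" by (auto simp: bij_betw_def)
    have "distr P P (\<lambda>x. \<lambda>j\<in>J. x (\<tau> j)) = P"
      unfolding P_def using prob_D \<tau>J inj by (intro distr_PiM_reindex[of J "\<lambda>_. D"]) auto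
    then have "(\<integral>x. f k x \<partial>P) = (\<integral>x. f k x \<partial>distr P P (\<lambda>x. \<lambda>j\<in>J. x (\<tau> j)))" by simp
    also have "\<dots> = (\<integral>x. f k (\<lambda>j\<in>J. x (\<tau> j)) \<partial>P)"
    proof (rule integral_distr)
      show "(\<lambda>x. \<lambda>j\<in>J. x (\<tau> j)) \<in> measurable P P"
        unfolding P_def using \<tau>J by (intro measurable_restrict measurable_component_singleton) auto
      show "f k \<in> borel_measurable P" using k by measurable
    qed
    also have "(\<lambda>x. f k (\<lambda>j\<in>J. x (\<tau> j))) = f i"
    proof
      fix x :: "'i \<Rightarrow> complex"
      have "(\<Sum>j\<in>J. (\<lambda>j\<in>J. x (\<tau> j)) j) = (\<Sum>j\<in>J. x (\<tau> j))" by (intro sum.cong) auto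
      also have "\<dots> = (\<Sum>j\<in>J. x j)" using sum.reindex_bij_betw[OF \<tau>] by auto
      finally show "f k (\<lambda>j\<in>J. x (\<tau> j)) = f i x"
        using k by (simp add: f_def \<tau>_def)
    qed
    finally show ?thesis .
  qed
  have sum_f: "(\<Sum>k\<in>J. f k (XJ \<omega>)) = cmod (\<Sum>j\<in>J. X j \<omega>)" for \<omega>
  proof -
    define T where "T = (\<Sum>j\<in>J. X j \<omega>)"
    have "(\<Sum>j\<in>J. XJ \<omega> j) = T" unfolding T_def XJ_def by (intro sum.cong) auto
    then have "(\<Sum>k\<in>J. f k (XJ \<omega>)) = Re (cis (Arg (cnj T)) * T)"
      unfolding f_def by (simp only: Re_sum[symmetric] sum_distrib_left[symmetric])
    also have "cis (Arg (cnj T)) * T = cmod T"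
    proof -
      have "cnj T = cmod T * cis (Arg (cnj T))"
        using rcis_cmod_Arg[of "cnj T"] by (simp add: rcis_def)
      then have "T = cmod T * cis (- Arg (cnj T))"
        by (metis complex_cnj_cnj complex_cnj_complex_of_real complex_cnj_mult cis_cnj)
      then have "cis (Arg (cnj T)) * T = cmod T * (cis (Arg (cnj T)) * cis (- Arg (cnj T)))"
        by (metis mult.left_commute)
      then show ?thesis by (simp add: cis_mult)
    qed
    finally show ?thesis by (simp add: T_def)
  qed
  \<comment> \<open>The known mean of the modulus splits into \<open>card J\<close> equal
    summands.\<close>
  have "sqrt (real (card J) * pi) / 2 = expectation (\<lambda>\<omega>. \<Sum>k\<in>J. f k (XJ \<omega>))"
    unfolding sum_f using complex_normal_sum_cmod[OF J] i
    by (intro has_bochner_integral_integral_eq[symmetric]) auto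
  also have "\<dots> = (\<Sum>k\<in>J. expectation (\<lambda>\<omega>. f k (XJ \<omega>)))"
    by (intro Bochner_Integration.integral_sum int_f)
  also have "\<dots> = (\<Sum>k\<in>J. expectation (\<lambda>\<omega>. f i (XJ \<omega>)))"
    by (intro sum.cong refl) (metis E_P exch i)
  finally have "real (card J) * expectation (\<lambda>\<omega>. f i (XJ \<omega>)) = sqrt (real (card J) * pi) / 2"
    by simp
  moreover define s where "s = sqrt (real (card J))"
  moreover have card_J: "real (card J) = s * s" and "0 < s"
    using i J by (auto simp: s_def card_gt_0_iff)
  ultimately have "expectation (\<lambda>\<omega>. f i (XJ \<omega>)) = sqrt (pi / real (card J)) / 2"
    unfolding card_J by (simp add: real_sqrt_mult real_sqrt_divide field_simps)
  moreover have "f i (XJ \<omega>) = Re (cis (Arg (cnj (\<Sum>j\<in>J. X j \<omega>))) * X i \<omega>)" for \<omega>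
    using i by (simp add: f_def XJ_def cong: sum.cong)
  ultimately show ?thesis
    using int_f[OF i] by (simp add: has_bochner_integral_iff)
qed

text \<open>The index \<open>a\<close> of the direct channel lies outside \<open>J\<close>, so the
  modulus and the aligned term depend on disjoint blocks of the family and their means
  multiply.\<close>

lemma gain_mean_aligned:
  assumes J: "insert a J \<subseteq> I" "finite J" "a \<notin> J" and i: "i \<in> J"
  shows "has_bochner_integral M
    (\<lambda>\<omega>. cmod (X a \<omega>) * Re (cis (Arg (cnj (\<Sum>j\<in>J. X j \<omega>))) * X i \<omega>))
    (pi / (4 * sqrt (real (card J))))"
proof -
  have a: "has_bochner_integral M (\<lambda>\<omega>. cmod (X a \<omega>)) (sqrt pi / 2)"
    using J by (intro complex_normal_cmod) auto
  have b: "has_bochner_integral M (\<lambda>\<omega>. Re (cis (Arg (cnj (\<Sum>j\<in>J. X j \<omega>))) * X i \<omega>))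
      (sqrt (pi / real (card J)) / 2)"
    using J i by (intro aligned_summand) auto
  have "indep_var borel ((\<lambda>x. cmod (x a)) \<circ> (\<lambda>\<omega>. \<lambda>j\<in>{a}. X j \<omega>))
      borel ((\<lambda>x. Re (cis (Arg (cnj (\<Sum>j\<in>J. x j))) * x i)) \<circ> (\<lambda>\<omega>. \<lambda>j\<in>J. X j \<omega>))"
    using J i by (intro indep_var_compose[OF indep_var_restrict[OF indep]]) measurable
  then have ind: "indep_var borel (\<lambda>\<omega>. cmod (X a \<omega>))
      borel (\<lambda>\<omega>. Re (cis (Arg (cnj (\<Sum>j\<in>J. X j \<omega>))) * X i \<omega>))"
    using i by (simp add: comp_def cong: sum.cong del: times_complex.sel)
  have "sqrt pi / 2 * (sqrt (pi / real (card J)) / 2) = pi / (4 * sqrt (real (card J)))"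
    by (simp add: real_sqrt_divide)
  then show ?thesis
    using a b indep_var_lebesgue_integral[OF ind] indep_var_integrable[OF ind]
    by (simp only: has_bochner_integral_iff simp_thms)
qed

text \<open>Modulus and phase involve only indices in \<open>insert a J\<close>, hence are
  independent of the centred \<open>X m\<close>. The product is formed over the complex numbers and
  its real part taken last.\<close>

lemma gain_mean_interferer:
  assumes J: "insert m (insert a J) \<subseteq> I" "finite J" "m \<notin> J" "m \<noteq> a"
  shows "has_bochner_integral M
    (\<lambda>\<omega>. cmod (X a \<omega>) * Re (cis (Arg (cnj (\<Sum>j\<in>J. X j \<omega>))) * X m \<omega>)) 0"
proof -
  define u where "u \<omega> = cmod (X a \<omega>) * cis (Arg (cnj (\<Sum>j\<in>J. X j \<omega>)))" for \<omega>
  have m: "has_bochner_integral M (X m) 0"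
    using J by (intro complex_normal_integral_0) auto
  have "indep_var borel ((\<lambda>x. cmod (x a) * cis (Arg (cnj (\<Sum>j\<in>J. x j)))) \<circ> (\<lambda>\<omega>. \<lambda>j\<in>insert a J. X j \<omega>))
      borel ((\<lambda>x. x m) \<circ> (\<lambda>\<omega>. \<lambda>j\<in>{m}. X j \<omega>))"
    using J by (intro indep_var_compose[OF indep_var_restrict[OF indep]]) auto
  then have ind: "indep_var borel u borel (X m)"
    by (simp add: comp_def u_def[abs_def] cong: sum.cong)
  have "integrable M (\<lambda>\<omega>. cmod (X a \<omega>))"
    using complex_normal_cmod[of a] J by (simp add: has_bochner_integral_iff)
  then have "integrable M u"
    by (rule Bochner_Integration.integrable_bound)
       (use indep_var_rv1[OF ind] in \<open>auto simp: u_def norm_mult\<close>)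
  then have "has_bochner_integral M (\<lambda>\<omega>. u \<omega> * X m \<omega>) 0"
    using m indep_var_lebesgue_integral[OF ind] indep_var_integrable[OF ind]
    by (simp add: has_bochner_integral_iff)
  from has_bochner_integral_Re[OF this] show ?thesis
    by (simp add: u_def mult.assoc algebra_simps)
qed

end

end

text \<open>The first part of each phase shift cancels the argument of \<open>cnj (hp $ n)\<close>
  and leaves its modulus. Since angles enter only through \<open>cis\<close>, a congruence modulo
  \<open>2 * \<pi>\<close> suffices.\<close>

lemma effective_gain_aligned:
  fixes hp hr :: "complex ^ 'n" and \<theta> :: "real ^ 'n"
  assumes "\<And>n. [\<theta> $ n = - Arg (cnj (hp $ n)) + \<phi> n] (rmod (2 * pi))"
  shows "effective_gain b p lam \<theta> hp hr =
    b * sqrt p / lam * (\<Sum>n\<in>UNIV. cmod (hp $ n) * Re (cis (\<phi> n) * hr $ n))"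
proof -
  have "cnj (hp $ n) * (reflecting_matrix \<theta> *v hr) $ n
      = complex_of_real (cmod (hp $ n)) * (cis (\<phi> n) * hr $ n)" for n
  proof -
    have "(reflecting_matrix \<theta> *v hr) $ n = cis (\<theta> $ n) * hr $ n"
      by (simp add: reflecting_matrix_def matrix_vector_mult_def mult_delta_left)
    also have "cis (\<theta> $ n) = cis (- Arg (cnj (hp $ n))) * cis (\<phi> n)"
      using cis_cong[OF assms[of n]] by (simp add: cis_mult)
    finally have "cnj (hp $ n) * (reflecting_matrix \<theta> *v hr) $ n
        = cnj (hp $ n) * cis (- Arg (cnj (hp $ n))) * (cis (\<phi> n) * hr $ n)"
      by (simp add: mult.assoc)
    moreover have "cnj (hp $ n) * cis (- Arg (cnj (hp $ n))) = cmod (hp $ n)"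
    proof -
      have "cnj (hp $ n) = cmod (hp $ n) * cis (Arg (cnj (hp $ n)))"
        using rcis_cmod_Arg[of "cnj (hp $ n)"] by (simp add: rcis_def)
      then have "cnj (hp $ n) * cis (- Arg (cnj (hp $ n)))
        = cmod (hp $ n) * (cis (Arg (cnj (hp $ n))) * cis (- Arg (cnj (hp $ n))))"
        by (metis mult.assoc)
      then show ?thesis by (simp add: cis_mult)
    qed
    ultimately show ?thesis by simp
  qed
  moreover have "Re (complex_of_real r * w) = r * Re w" for r w by simp
  ultimately show ?thesis
    by (simp only: effective_gain_def hermitian_prod_def Re_sum)
qed

section \<open>Means of the coefficients and of the gradient estimate\<close>

theorem proposition1:
  fixes \<Omega> :: "'w measure"
    and K M :: nat
    and \<sigma> \<zeta> lam G :: real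
    and \<beta> P p :: "nat \<Rightarrow> real"
    and hp :: "'w \<Rightarrow> complex ^ 'n"
    and hr :: "nat \<Rightarrow> 'w \<Rightarrow> complex ^ 'n"
    and z :: "'w \<Rightarrow> complex ^ 'd"
    and g gi :: "nat \<Rightarrow> real ^ 'd"
    and \<theta> :: "'w \<Rightarrow> real ^ 'n"
    and l :: "nat \<Rightarrow> 'w \<Rightarrow> real"
  assumes "prob_space \<Omega>"
    and "K \<ge> 1" and "M \<ge> 1"
    and "channel_model \<Omega> {1..K+M} \<sigma> hp hr z"
    and "\<And>i. i \<in> {1..K+M} \<Longrightarrow> \<beta> i > 0"
    and "\<And>i. i \<in> {1..K+M} \<Longrightarrow> p i > 0"
    and "\<And>k. k \<in> {1..K} \<Longrightarrow> P k > 0"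
    and "G > 0"
    and "\<And>k. k \<in> {1..K} \<Longrightarrow> norm (g k) \<le> G"
    and "\<And>m. m \<in> {K+1..K+M} \<Longrightarrow> norm (gi m) = 1"
    and "\<zeta> = (MIN k\<in>{1..K}. sqrt (P k) * \<beta> k) / G"
    and "\<And>k. k \<in> {1..K} \<Longrightarrow> sqrt (p k) = inverse (\<beta> k) * \<zeta>"
    and "lam = pi * real CARD('n) * sqrt (real K) * (MIN k\<in>{1..K}. sqrt (P k) * \<beta> k) / (4 * G)"
    and "\<And>\<omega> n. \<omega> \<in> space \<Omega> \<Longrightarrow>
           [\<theta> \<omega> $ n = - Arg (cnj (hp \<omega> $ n)) + Arg (\<Sum>k\<in>{1..K}. cnj (hr k \<omega> $ n))] (rmod (2 * pi))"
    and "\<And>i \<omega>. l i \<omega> = effective_gain (\<beta> i) (p i) lam (\<theta> \<omega>) (hp \<omega>) (hr i \<omega>)"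
  shows "has_bochner_integral \<Omega> (\<lambda>\<omega>. gradient_estimate K M lam (\<lambda>i. l i \<omega>) g gi (z \<omega>))
           (global_gradient K g)
       \<and> (\<forall>k\<in>{1..K}. has_bochner_integral \<Omega> (l k) (1 / real K))
       \<and> (\<forall>m\<in>{K+1..K+M}. has_bochner_integral \<Omega> (l m) 0)"
proof -
  interpret prob_space \<Omega> by (rule assms(1))
  define mn where "mn = (MIN k\<in>{1..K}. sqrt (P k) * \<beta> k)"
  \<comment> \<open>For fixed \<open>n\<close>, the \<open>n\<close>-th entries of all channel
    vectors form one independent family; \<open>None\<close> is the direct channel and
    \<open>J\<close> holds the targets.\<close>
  define X where "X n j \<omega> = channels hp hr j \<omega> $ n" for n j \<omega>
  define J where "J = Some ` {1..K}"
  define W where "W i n \<omega> = cmod (hp \<omega> $ n) *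
    Re (cis (Arg (\<Sum>k\<in>{1..K}. cnj (hr k \<omega> $ n))) * hr i \<omega> $ n)" for i n \<omega>
  have indep_channels: "indep_vars (\<lambda>_. borel) (channels hp hr) (channel_index {1..K+M})"
    and cn_channels: "\<And>j. j \<in> channel_index {1..K+M} \<Longrightarrow> cn_vector \<Omega> 1 (channels hp hr j)"
    and cn_z: "cn_vector \<Omega> (\<sigma>\<^sup>2) z"
    using assms(4) unfolding channel_model_def by (auto simp: channel_index_def channels_def)
  have indep: "indep_vars (\<lambda>_. borel) (X n) (channel_index {1..K+M})" for n
    unfolding X_def[abs_def]
    by (rule indep_vars_compose2[OF indep_channels, where Y="\<lambda>_ v. v $ n"]) measurable
  have cn: "distr \<Omega> borel (X n j) = complex_normal 1" if "j \<in> channel_index {1..K+M}" for n j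
    using cn_channels[OF that] unfolding X_def[abs_def] cn_vector_def by blast
  have fin_J: "finite J" and card_J: "card J = K"
    by (simp_all add: J_def card_image)
  have X_None: "X n None \<omega> = hp \<omega> $ n" and X_Some: "X n (Some i) \<omega> = hr i \<omega> $ n" for n i \<omega>
    by (simp_all add: X_def channels_def)
  have sum_J: "cnj (\<Sum>j\<in>J. X n j \<omega>) = (\<Sum>k\<in>{1..K}. cnj (hr k \<omega> $ n))" for n \<omega>
    by (simp add: J_def sum.reindex X_Some)
  have W_eq: "cmod (X n None \<omega>) * Re (cis (Arg (cnj (\<Sum>j\<in>J. X n j \<omega>))) * X n (Some i) \<omega>)
      = W i n \<omega>" for i n \<omega>
    by (simp only: W_def sum_J X_None X_Some)
  have None_J: "insert None J \<subseteq> channel_index {1..K+M}" "None \<notin> J"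
    by (auto simp: J_def channel_index_def)
  have W_target: "has_bochner_integral \<Omega> (W k n) (pi / (4 * sqrt (real K)))" if "k \<in> {1..K}" for k n
  proof -
    have "Some k \<in> J" using that by (simp add: J_def)
    from gain_mean_aligned[OF indep[of n] cn None_J(1) fin_J None_J(2) this]
    show ?thesis unfolding W_eq card_J .
  qed
  have W_interferer: "has_bochner_integral \<Omega> (W m n) 0" if "m \<in> {K+1..K+M}" for m n
  proof -
    have "insert (Some m) (insert None J) \<subseteq> channel_index {1..K+M}" "Some m \<notin> J" "Some m \<noteq> None"
      using that None_J(1) by (auto simp: J_def channel_index_def)
    from gain_mean_interferer[OF indep[of n] cn this(1) fin_J this(2,3)]
    show ?thesis unfolding W_eq .
  qed
  \<comment> \<open>The phase rule is assumed only on the sample space, which is all that the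
    integral sees.\<close>
  have l_eq: "l i \<omega> = \<beta> i * sqrt (p i) / lam * (\<Sum>n\<in>UNIV. W i n \<omega>)" if "\<omega> \<in> space \<Omega>" for i \<omega>
    unfolding assms(15) W_def using assms(14) that by (intro effective_gain_aligned) auto
  have l_int: "has_bochner_integral \<Omega> (l i) (\<beta> i * sqrt (p i) / lam * (\<Sum>n\<in>(UNIV :: 'n set). c))"
    if "\<And>n. has_bochner_integral \<Omega> (W i n) c" for i c
  proof -
    have "has_bochner_integral \<Omega> (\<lambda>\<omega>. \<beta> i * sqrt (p i) / lam * (\<Sum>n\<in>UNIV. W i n \<omega>))
        (\<beta> i * sqrt (p i) / lam * (\<Sum>n\<in>(UNIV :: 'n set). c))"
      by (intro has_bochner_integral_mult_right has_bochner_integral_sum that)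
    then show ?thesis
      by (subst has_bochner_integral_cong[OF refl l_eq refl]) auto
  qed
  \<comment> \<open>Positivity makes \<open>lam\<close> nonzero and lets the minimum cancel.\<close>
  have mn: "mn > 0"
    unfolding mn_def using assms(2,5,7) by (subst Min_gr_iff) auto
  have target: "has_bochner_integral \<Omega> (l k) (1 / real K)" if k: "k \<in> {1..K}" for k
  proof -
    have "\<beta> k > 0" using assms(5)[of k] k by simp
    \<comment> \<open>The power choice inverts the fading, so all targets share the factor
      \<open>\<zeta>\<close>.\<close>
    then have gain: "\<beta> k * sqrt (p k) = mn / G"
      using assms(11) assms(12)[OF k] by (simp add: mn_def)
    define s where "s = sqrt (real K)"
    have s: "real K = s * s" "0 < s" using assms(2) by (auto simp: s_def)
    have lam: "lam = pi * real CARD('n) * s * mn / (4 * G)"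
      using assms(13) by (simp add: mn_def s_def)
    \<comment> \<open>Here \<open>lam\<close> is \<open>mn / G\<close> times
      \<open>CARD('n) * \<pi> * s / 4\<close>, while the entries sum to
      \<open>CARD('n) * \<pi> / (4 * s)\<close>; the quotient leaves
      \<open>1 / (s * s)\<close>.\<close>
    have "\<beta> k * sqrt (p k) / lam * (\<Sum>n\<in>(UNIV :: 'n set). pi / (4 * sqrt (real K))) = 1 / real K"
      unfolding gain lam s_def[symmetric] s(1) using mn assms(8) s(2) by (simp add: field_simps)
    with l_int[OF W_target[OF k]] show ?thesis by simp
  qed
  have interferer: "has_bochner_integral \<Omega> (l m) 0" if "m \<in> {K+1..K+M}" for m
    using l_int[OF W_interferer[OF that]] by simp
  have z_int: "has_bochner_integral \<Omega> (\<lambda>\<omega>. Re (z \<omega> $ d)) 0" for d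
  proof (rule complex_normal_Re_mean)
    have "z \<in> borel_measurable \<Omega>" using cn_z unfolding cn_vector_def by blast
    then show "(\<lambda>\<omega>. z \<omega> $ d) \<in> borel_measurable \<Omega>" by measurable
    show "distr \<Omega> borel (\<lambda>\<omega>. z \<omega> $ d) = complex_normal (\<sigma>\<^sup>2)"
      using cn_z unfolding cn_vector_def by blast
  qed
  have noise: "has_bochner_integral \<Omega> (\<lambda>\<omega>. \<chi> d. Re (z \<omega> $ d)) (0 :: real ^ 'd)"
  proof -
    \<comment> \<open>Expansion in the standard basis turns the vector mean into coordinate
      means.\<close>
    have "has_bochner_integral \<Omega> (\<lambda>\<omega>. \<Sum>d\<in>UNIV. Re (z \<omega> $ d) *\<^sub>R axis d (1 :: real))
        (\<Sum>d\<in>UNIV. 0 *\<^sub>R axis d (1 :: real) :: real ^ 'd)"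
      by (intro has_bochner_integral_sum has_bochner_integral_scaleR_left z_int)
    moreover have "(\<Sum>d\<in>UNIV. Re (z \<omega> $ d) *\<^sub>R axis d 1) = (\<chi> d. Re (z \<omega> $ d))" for \<omega>
      using basis_expansion[of "\<chi> d. Re (z \<omega> $ d)"] by (simp add: scalar_mult_eq_scaleR)
    ultimately show ?thesis by simp
  qed
  have "has_bochner_integral \<Omega> (\<lambda>\<omega>. gradient_estimate K M lam (\<lambda>i. l i \<omega>) g gi (z \<omega>))
      ((\<Sum>k\<in>{1..K}. (1 / real K) *\<^sub>R g k) + (\<Sum>m\<in>{K+1..K+M}. 0 *\<^sub>R gi m) + (1 / lam) *\<^sub>R 0)"
    unfolding gradient_estimate_def
    by (intro has_bochner_integral_add has_bochner_integral_sum has_bochner_integral_scaleR_left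
        has_bochner_integral_scaleR_right target interferer noise)
  then show ?thesis
    using target interferer by (simp add: global_gradient_def scaleR_sum_right)
qed

end
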